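(* Let $(X_n)_{n\ge 0}$ be a sequence of i.i.d. real-valued random variables with mean $\mu=E(X_0)$ and variance $\sigma^2=\mathrm{Var}(X_0)$ satisfying $0<\sigma^2<\infty$. For $a\in[0,1)$ let $S_a=\sum_{n=0}^\infty a^nX_n$, let $$\hat S_a=\frac{S_a-E(S_a)}{\sqrt{\mathrm{Var}(S_a)}}=\frac{\sqrt{1-a^2}}{\sigma}\left(S_a-\frac{\mu}{1-a}\right),$$ and let $F_a(x)=P(\hat S_a\le x)$ be the distribution function of $\hat S_a$. Let $\Phi(x)=\frac{1}{\sqrt{2\pi}}\int_{-\infty}^x e^{-u^2/2}\,du$ be the standard normal distribution function. Then $$\lim_{a\to 1-}d_2(F_a,\Phi)=0,$$ where $d_2$ is the Fourier distance of type $2$.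
   Context: The series defining $S_a$ converges almost surely. For a probability distribution function $G$ on $\mathbb{R}$, its characteristic function is $C_G(\xi)=\int_{-\infty}^\infty e^{-i\xi x}\,dG(x)$. For real $s>0$ and probability distribution functions $G,H$ on $\mathbb{R}$, the Fourier distance of type $s$ is $$d_s(G,H)=\sup_{\xi\neq 0}\frac{|C_G(\xi)-C_H(\xi)|}{|\xi|^s}.$$ *)

theory Defs
  imports "HOL-Probability.Probability"
begin

text \<open>The integral \<open>dG\<close> is taken with respect to the Lebesgue--Stieltjes measure of \<open>G\<close>.
  The sign in the exponent is opposite to that of \<^const>\<open>char\<close>.\<close>

definition char_df :: "(real \<Rightarrow> real) \<Rightarrow> real \<Rightarrow> complex" where
  "char_df G \<xi> = (CLINT x | interval_measure G. exp (- \<i> * complex_of_real \<xi> * complex_of_real x))"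

text \<open>The supremum may be infinite, hence the extended nonnegative reals.\<close>

definition fourier_dist :: "real \<Rightarrow> (real \<Rightarrow> real) \<Rightarrow> (real \<Rightarrow> real) \<Rightarrow> ennreal" where
  "fourier_dist s G H =
     (SUP \<xi> \<in> - {0}. ennreal (cmod (char_df G \<xi> - char_df H \<xi>) / \<bar>\<xi>\<bar> powr s))"

definition discounted_sum :: "(nat \<Rightarrow> 'a \<Rightarrow> real) \<Rightarrow> real \<Rightarrow> 'a \<Rightarrow> real" where
  "discounted_sum X a \<omega> = (\<Sum>n. a ^ n * X n \<omega>)"

definition standardized :: "'a measure \<Rightarrow> ('a \<Rightarrow> real) \<Rightarrow> 'a \<Rightarrow> real" where
  "standardized M Y \<omega> =
     (Y \<omega> - prob_space.expectation M Y) / sqrt (prob_space.variance M Y)"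

definition dist_fun :: "'a measure \<Rightarrow> ('a \<Rightarrow> real) \<Rightarrow> real \<Rightarrow> real" where
  "dist_fun M Y x = \<P>(\<omega> in M. Y \<omega> \<le> x)"

definition std_normal_df :: "real \<Rightarrow> real" where
  "std_normal_df x = 1 / sqrt (2 * pi) * (LBINT u:{..x}. exp (- u\<^sup>2 / 2))"

end

theory Submission
  imports Defs
begin

text \<open>Let \<open>Y\<^sub>n = (X\<^sub>n - \<mu>) / \<sigma>\<close> have characteristic function \<open>\<psi>\<close>, and let \<open>c = sqrt (1 - a\<^sup>2)\<close>. By
  independence the characteristic function of the standardized sum is the product of the factors
  \<open>\<psi> (c a\<^sup>n \<xi>)\<close>, while \<open>exp (- \<xi>\<^sup>2 / 2)\<close> is the product of the \<open>exp (- (c a\<^sup>n \<xi>)\<^sup>2 / 2)\<close> because the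
  weights \<open>(c a\<^sup>n)\<^sup>2\<close> sum to \<open>1\<close>. All factors are bounded by \<open>1\<close>, so the difference of the products
  is at most the sum of the differences of the factors. If these are at most \<open>\<delta> t\<^sup>2\<close> at \<open>t = c a\<^sup>n \<xi>\<close>,
  as they are when \<open>c \<bar>\<xi>\<bar> < r\<close> by the second-order expansion of \<open>\<psi>\<close>, that sum is at most \<open>\<delta> \<xi>\<^sup>2\<close>.
  For \<open>c \<bar>\<xi>\<bar> \<ge> r\<close> the trivial bound \<open>2 / \<xi>\<^sup>2 \<le> 2 c\<^sup>2 / r\<^sup>2\<close> tends to \<open>0\<close> as \<open>a\<close> tends to \<open>1\<close>.\<close>

section \<open>Characteristic functions of distribution functions\<close>

text \<open>A distribution on the line is determined by its distribution function. Hence the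
  Stieltjes integral in \<open>char_df\<close> becomes an integral against the original law, and
  results on \<open>char\<close> apply.\<close>

lemma interval_measure_cdf:
  assumes "real_distribution D"
  shows "interval_measure (cdf D) = D"
proof -
  interpret real_distribution D by fact
  show ?thesis
    by (intro cdf_unique real_distribution_interval_measure assms cdf_interval_measure
        cdf_nondecreasing cdf_is_right_cont cdf_lim_at_bot cdf_lim_at_top_prob)
qed

lemma char_df_cdf:
  assumes "real_distribution D"
  shows "char_df (cdf D) \<xi> = char D (- \<xi>)"
  unfolding char_df_def char_def interval_measure_cdf[OF assms] by (simp add: mult.assoc)

lemma std_normal_df_eq_cdf: "std_normal_df = cdf std_normal_distribution"
proof
  fix x :: real
  interpret real_distribution std_normal_distribution
    by (rule real_dist_normal_dist)
  have "cdf std_normal_distribution x = (LINT u|std_normal_distribution. indicator {..x} u)"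
    by (simp add: cdf_def)
  also have "\<dots> = (LINT u|lborel. std_normal_density u * indicator {..x} u)"
    by (subst integral_density) auto
  also have "\<dots> = (LINT u|lborel. 1 / sqrt (2 * pi) * (indicator {..x} u * exp (- u\<^sup>2 / 2)))"
    by (intro Bochner_Integration.integral_cong) (auto simp: std_normal_density_def)
  also have "\<dots> = std_normal_df x"
    by (simp add: std_normal_df_def set_lebesgue_integral_def)
  finally show "std_normal_df x = cdf std_normal_distribution x" by simp
qed

lemma (in prob_space) dist_fun_eq_cdf:
  assumes [measurable]: "random_variable borel Y"
  shows "dist_fun M Y = cdf (distr M borel Y)"
proof
  fix x
  show "dist_fun M Y x = cdf (distr M borel Y) x"
    by (auto simp: dist_fun_def cdf_def measure_distr intro!: arg_cong[where f="measure M"])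
qed

text \<open>The Taylor remainder is at most \<open>t\<^sup>2 / 6\<close> times the expectation of a
  minimum. Its cubic entry carries a factor \<open>\<bar>t\<bar>\<close> and vanishes pointwise,
  while \<open>6 * x\<^sup>2\<close> is an integrable majorant, so dominated convergence along
  sequences sends this expectation to 0.\<close>

lemma (in real_distribution) char_second_order_at_0:
  assumes "integrable M (\<lambda>x. x\<^sup>2)" "expectation (\<lambda>x. x) = 0" "expectation (\<lambda>x. x\<^sup>2) = 1"
    and "\<delta> > 0"
  shows "eventually (\<lambda>t. cmod (char M t - (1 - t\<^sup>2 / 2)) \<le> \<delta> * t\<^sup>2) (nhds 0)"
proof -
  let ?e = "\<lambda>t. expectation (\<lambda>x. min (6 * x\<^sup>2) (\<bar>t\<bar> * \<bar>x\<bar> ^ 3))"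
  have int: "integrable M (\<lambda>x. x)"
    by (rule square_integrable_imp_integrable[OF _ assms(1)]) simp
  have "isCont ?e 0"
    unfolding continuous_at_sequentially
  proof (intro allI impI)
    fix X :: "nat \<Rightarrow> real" assume X: "X \<longlonglongrightarrow> 0"
    show "(?e \<circ> X) \<longlonglongrightarrow> ?e 0"
      unfolding comp_def
    proof (rule integral_dominated_convergence[where w="\<lambda>x. 6 * x\<^sup>2"])
      show "AE x in M. (\<lambda>n. min (6 * x\<^sup>2) (\<bar>X n\<bar> * \<bar>x\<bar> ^ 3)) \<longlonglongrightarrow> min (6 * x\<^sup>2) (\<bar>0\<bar> * \<bar>x\<bar> ^ 3)"
        by (intro AE_I2 tendsto_intros X)
    qed (auto intro: assms(1))
  qed
  then have "(?e \<longlongrightarrow> ?e 0) (nhds 0)"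
    using tendsto_at_iff_tendsto_nhds[of ?e 0] by (simp only: isCont_def)
  then have "eventually (\<lambda>t. ?e t < 6 * \<delta>) (nhds 0)"
    using \<open>\<delta> > 0\<close> by (intro order_tendstoD) auto
  then show ?thesis
  proof eventually_elim
    case (elim t)
    have "cmod (char M t - (1 - t\<^sup>2 / 2)) \<le> t\<^sup>2 / 6 * ?e t"
      using char_approx3[of 1 t] int assms by simp
    also have "\<dots> \<le> t\<^sup>2 / 6 * (6 * \<delta>)"
      using elim by (intro mult_left_mono) auto
    finally show ?case by (simp add: mult.commute)
  qed
qed

text \<open>By monotone convergence the integral of the sum is the sum of the integrals. This is
  finite, so the sum is finite almost everywhere.\<close>

lemma AE_summable_of_summable_integral:
  fixes f :: "nat \<Rightarrow> 'a \<Rightarrow> real"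
  assumes int: "\<And>n. integrable M (f n)" and nonneg: "\<And>n x. 0 \<le> f n x"
    and summable: "summable (\<lambda>n. LINT x|M. f n x)"
  shows "AE x in M. summable (\<lambda>n. f n x)"
proof -
  have [measurable]: "f n \<in> borel_measurable M" for n using int by auto
  have "(\<integral>\<^sup>+x. (\<Sum>n. ennreal (f n x)) \<partial>M) = (\<Sum>n. \<integral>\<^sup>+x. ennreal (f n x) \<partial>M)"
    by (rule nn_integral_suminf) measurable
  also have "\<dots> = (\<Sum>n. ennreal (LINT x|M. f n x))"
    by (intro suminf_cong nn_integral_eq_integral int AE_I2 nonneg)
  also have "\<dots> \<noteq> \<infinity>"
    using summable by (simp add: ennreal_suminf_neq_top nonneg)
  finally have "AE x in M. (\<Sum>n. ennreal (f n x)) \<noteq> \<infinity>"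
    by (intro nn_integral_PInf_AE) measurable
  then show ?thesis
    by eventually_elim (auto intro!: summable_suminf_not_top nonneg)
qed

section \<open>Discounted sums of standardized variables\<close>

locale iid_standardized = prob_space +
  fixes Y :: "nat \<Rightarrow> 'a \<Rightarrow> real"
  assumes indep: "indep_vars (\<lambda>_. borel) Y UNIV"
    and ident: "\<And>n. distr M borel (Y n) = distr M borel (Y 0)"
    and square_integrable_0: "integrable M (\<lambda>\<omega>. (Y 0 \<omega>)\<^sup>2)"
    and mean_0: "expectation (Y 0) = 0"
    and second_moment_0: "expectation (\<lambda>\<omega>. (Y 0 \<omega>)\<^sup>2) = 1"
begin

lemma measurable_Y [measurable]: "random_variable borel (Y n)"
  using indep by (auto simp: indep_vars_def2)

lemma measurable_discounted_sum [measurable]: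
  "random_variable borel (discounted_sum Y a)"
  unfolding discounted_sum_def[abs_def] by measurable

section \<open>Moments of the individual variables\<close>

lemma integrable_transfer:
  fixes g :: "real \<Rightarrow> real"
  assumes [measurable]: "g \<in> borel_measurable borel"
  shows "integrable M (\<lambda>\<omega>. g (Y n \<omega>)) \<longleftrightarrow> integrable M (\<lambda>\<omega>. g (Y 0 \<omega>))"
  using integrable_distr_eq[of "Y n" M borel g] integrable_distr_eq[of "Y 0" M borel g] ident[of n]
  by simp

lemma expectation_transfer:
  fixes g :: "real \<Rightarrow> real"
  assumes [measurable]: "g \<in> borel_measurable borel"
  shows "expectation (\<lambda>\<omega>. g (Y n \<omega>)) = expectation (\<lambda>\<omega>. g (Y 0 \<omega>))"
  using integral_distr[of "Y n" M borel g] integral_distr[of "Y 0" M borel g] ident[of n]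
  by simp

lemma square_integrable: "integrable M (\<lambda>\<omega>. (Y n \<omega>)\<^sup>2)"
  using integrable_transfer[of "\<lambda>x. x\<^sup>2" n] square_integrable_0 by simp

lemma integrable_Y: "integrable M (Y n)"
  by (rule square_integrable_imp_integrable[OF _ square_integrable]) simp

lemma mean: "expectation (Y n) = 0"
  using expectation_transfer[of "\<lambda>x. x" n] mean_0 by simp

lemma second_moment: "expectation (\<lambda>\<omega>. (Y n \<omega>)\<^sup>2) = 1"
  using expectation_transfer[of "\<lambda>x. x\<^sup>2" n] second_moment_0 by simp

section \<open>Almost sure convergence of the series\<close>

text \<open>The expectations of the terms form a geometric series. The weight \<open>a ^ n\<close>,
  rather than its square, makes this sum a majorant both for absolute convergence and for the
  squared partial sums.\<close>

lemma AE_summable_squares: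
  assumes "0 \<le> a" "a < 1"
  shows "AE \<omega> in M. summable (\<lambda>n. a ^ n * (Y n \<omega>)\<^sup>2)"
  using assms
  by (intro AE_summable_of_summable_integral)
     (auto simp: square_integrable second_moment intro!: summable_geometric)

text \<open>The inequality \<open>\<bar>y\<bar> \<le> 1 + y\<^sup>2\<close> bounds the terms by a
  geometric series plus the summable weighted squares.\<close>

lemma AE_abs_summable:
  assumes a: "0 \<le> a" "a < 1"
  shows "AE \<omega> in M. summable (\<lambda>n. \<bar>a ^ n * Y n \<omega>\<bar>)"
  using AE_summable_squares[OF a]
proof eventually_elim
  case (elim \<omega>)
  have le: "\<bar>y\<bar> \<le> 1 + y\<^sup>2" for y :: real
    using zero_le_power2[of "\<bar>y\<bar> - 1"] by (simp add: power2_diff)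
  have "summable (\<lambda>n. a ^ n + a ^ n * (Y n \<omega>)\<^sup>2)"
    using a elim by (intro summable_add summable_geometric) auto
  then show ?case
  proof (rule summable_comparison_test')
    fix n :: nat
    show "norm \<bar>a ^ n * Y n \<omega>\<bar> \<le> a ^ n + a ^ n * (Y n \<omega>)\<^sup>2"
      using mult_left_mono[OF le[of "Y n \<omega>"], of "a ^ n"] a
      by (simp add: abs_mult algebra_simps)
  qed
qed

lemma AE_summable:
  assumes a: "0 \<le> a" "a < 1"
  shows "AE \<omega> in M. summable (\<lambda>n. a ^ n * Y n \<omega>)"
  using AE_abs_summable[OF a] by eventually_elim (rule summable_rabs_cancel)

lemma AE_partial_sums_tendsto:
  assumes a: "0 \<le> a" "a < 1"
  shows "AE \<omega> in M. (\<lambda>N. \<Sum>n<N. a ^ n * Y n \<omega>) \<longlonglongrightarrow> discounted_sum Y a \<omega>"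
  using AE_summable[OF a]
  by eventually_elim (auto simp: discounted_sum_def intro!: summable_LIMSEQ)

section \<open>First and second moments of the discounted sum\<close>

lemma discounted_sum_mean:
  assumes a: "0 \<le> a" "a < 1"
  shows "integrable M (discounted_sum Y a)" "expectation (discounted_sum Y a) = 0"
proof -
  \<comment> \<open>The first absolute moments are all equal, so this series is geometric; it
    justifies integrating the sum term by term.\<close>
  have s: "summable (\<lambda>n. expectation (\<lambda>\<omega>. norm (a ^ n * Y n \<omega>)))"
  proof -
    have "expectation (\<lambda>\<omega>. norm (a ^ n * Y n \<omega>)) = a ^ n * expectation (\<lambda>\<omega>. \<bar>Y 0 \<omega>\<bar>)" for n
      using expectation_transfer[of abs n] a by (simp add: abs_mult)
    then show ?thesis
      using a by (simp add: summable_mult2)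
  qed
  have ae: "AE \<omega> in M. summable (\<lambda>n. norm (a ^ n * Y n \<omega>))"
    using AE_abs_summable[OF a] by simp
  have int: "integrable M (\<lambda>\<omega>. a ^ n * Y n \<omega>)" for n
    by (simp add: integrable_Y)
  show "integrable M (discounted_sum Y a)"
    unfolding discounted_sum_def[abs_def] using int ae s by (rule integrable_suminf)
  show "expectation (discounted_sum Y a) = 0"
    unfolding discounted_sum_def[abs_def] integral_suminf[OF int ae s] by (simp add: mean)
qed

text \<open>The new term is centred and independent of the previous partial sum, so the cross term
  has expectation 0. Integrability is carried through the induction because linearity of the
  expectation requires it.\<close>

lemma partial_sum_second_moment:
  "integrable M (\<lambda>\<omega>. (\<Sum>n<N. a ^ n * Y n \<omega>)\<^sup>2) \<and>
   expectation (\<lambda>\<omega>. (\<Sum>n<N. a ^ n * Y n \<omega>)\<^sup>2) = (\<Sum>n<N. (a\<^sup>2) ^ n)"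
proof (induction N)
  case (Suc N)
  let ?Z = "\<lambda>n \<omega>. a ^ n * Y n \<omega>"
  let ?S = "\<lambda>\<omega>. \<Sum>n<N. ?Z n \<omega>"
  have "indep_vars (\<lambda>_. borel) ?Z UNIV"
    using indep by (rule indep_vars_compose2) simp
  then have "indep_vars (\<lambda>_. borel) ?Z (insert N {..<N})"
    by (rule indep_vars_subset) simp
  then have indep: "indep_var borel (?Z N) borel ?S"
    by (intro indep_vars_sum) auto
  have int: "integrable M (?Z N)" "integrable M ?S"
    by (auto simp: integrable_Y)
  have prod: "integrable M (\<lambda>\<omega>. ?Z N \<omega> * ?S \<omega>)" "expectation (\<lambda>\<omega>. ?Z N \<omega> * ?S \<omega>) = 0"
    using indep_var_integrable[OF indep int] indep_var_lebesgue_integral[OF indep int]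
    by (simp_all add: mean)
  have sq: "integrable M (\<lambda>\<omega>. (?Z N \<omega>)\<^sup>2)" "expectation (\<lambda>\<omega>. (?Z N \<omega>)\<^sup>2) = (a\<^sup>2) ^ N"
    by (simp_all add: power_mult_distrib square_integrable second_moment power_mult[symmetric]
        mult.commute)
  have "(\<lambda>\<omega>. (\<Sum>n<Suc N. ?Z n \<omega>)\<^sup>2) = (\<lambda>\<omega>. (?S \<omega>)\<^sup>2 + (2 * (?Z N \<omega> * ?S \<omega>) + (?Z N \<omega>)\<^sup>2))"
    by (auto simp: power2_sum algebra_simps)
  then show ?case
    using Suc sq prod by simp
qed simp

text \<open>Cauchy-Schwarz with \<open>a ^ n\<close> split into two square roots. The bound does not
  depend on \<open>N\<close>, which makes it a majorant for dominated convergence.\<close>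

lemma partial_sum_square_le:
  assumes a: "0 \<le> a" "a < 1" and "summable (\<lambda>n. a ^ n * (Y n \<omega>)\<^sup>2)"
  shows "(\<Sum>n<N. a ^ n * Y n \<omega>)\<^sup>2 \<le> 1 / (1 - a) * (\<Sum>n. a ^ n * (Y n \<omega>)\<^sup>2)"
proof -
  let ?r = "\<lambda>n. sqrt (a ^ n)"
  have "(\<Sum>n<N. a ^ n * Y n \<omega>)\<^sup>2 = (\<Sum>n<N. ?r n * (?r n * Y n \<omega>))\<^sup>2"
    using a by (simp flip: mult.assoc)
  also have "\<dots> \<le> (\<Sum>n<N. (?r n)\<^sup>2) * (\<Sum>n<N. (?r n * Y n \<omega>)\<^sup>2)"
    by (rule Cauchy_Schwarz_ineq_sum)
  also have "\<dots> = (\<Sum>n<N. a ^ n) * (\<Sum>n<N. a ^ n * (Y n \<omega>)\<^sup>2)"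
    using a by (simp add: power_mult_distrib)
  also have "\<dots> \<le> (\<Sum>n. a ^ n) * (\<Sum>n. a ^ n * (Y n \<omega>)\<^sup>2)"
    using assms by (intro mult_mono sum_le_suminf suminf_nonneg sum_nonneg summable_geometric) auto
  also have "(\<Sum>n. a ^ n) = 1 / (1 - a)"
    using a by (intro suminf_geometric) auto
  finally show ?thesis .
qed

text \<open>The second moments of the partial sums have two limits: the claimed expectation, by
  dominated convergence, and the value of a geometric series.\<close>

lemma discounted_sum_second_moment:
  assumes a: "0 \<le> a" "a < 1"
  shows "expectation (\<lambda>\<omega>. (discounted_sum Y a \<omega>)\<^sup>2) = 1 / (1 - a\<^sup>2)"
proof (rule LIMSEQ_unique)
  have int: "integrable M (\<lambda>\<omega>. \<Sum>n. a ^ n * (Y n \<omega>)\<^sup>2)"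
    using AE_summable_squares[OF a] a
    by (intro integrable_suminf) (auto simp: square_integrable second_moment summable_geometric)
  show "(\<lambda>N. expectation (\<lambda>\<omega>. (\<Sum>n<N. a ^ n * Y n \<omega>)\<^sup>2))
          \<longlonglongrightarrow> expectation (\<lambda>\<omega>. (discounted_sum Y a \<omega>)\<^sup>2)"
  proof (rule integral_dominated_convergence)
    show "integrable M (\<lambda>\<omega>. 1 / (1 - a) * (\<Sum>n. a ^ n * (Y n \<omega>)\<^sup>2))"
      using int by (rule integrable_mult_right)
    show "AE \<omega> in M. (\<lambda>N. (\<Sum>n<N. a ^ n * Y n \<omega>)\<^sup>2) \<longlonglongrightarrow> (discounted_sum Y a \<omega>)\<^sup>2"
      using AE_partial_sums_tendsto[OF a] by eventually_elim (rule tendsto_power)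
    show "AE \<omega> in M. norm ((\<Sum>n<N. a ^ n * Y n \<omega>)\<^sup>2)
            \<le> 1 / (1 - a) * (\<Sum>n. a ^ n * (Y n \<omega>)\<^sup>2)" for N
      using AE_summable_squares[OF a]
      by eventually_elim (use partial_sum_square_le[OF a] in simp)
  qed measurable
  have "a\<^sup>2 < 1" using a by (simp add: power_less_one_iff)
  then show "(\<lambda>N. expectation (\<lambda>\<omega>. (\<Sum>n<N. a ^ n * Y n \<omega>)\<^sup>2)) \<longlonglongrightarrow> 1 / (1 - a\<^sup>2)"
    using geometric_sums[of "a\<^sup>2"] by (simp add: partial_sum_second_moment sums_def)
qed

section \<open>The Fourier distance to the normal distribution\<close>

abbreviation law where "law \<equiv> distr M borel (Y 0)"

text \<open>Both laws have mean 0 and second moment 1, so they share the expansion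
  \<open>1 - t\<^sup>2 / 2\<close>; each contributes half of \<delta> to the error.\<close>

lemma char_law_near_normal:
  assumes "\<delta> > 0"
  obtains r where "r > 0"
    "\<And>t. \<bar>t\<bar> < r \<Longrightarrow> cmod (char law t - of_real (exp (- t\<^sup>2 / 2))) \<le> \<delta> * t\<^sup>2"
proof -
  interpret L: real_distribution law by simp
  interpret N: real_distribution std_normal_distribution by (rule real_dist_normal_dist)
  have d: "\<delta> / 2 > 0" using assms by simp
  have "eventually (\<lambda>t. cmod (char law t - (1 - t\<^sup>2 / 2)) \<le> \<delta> / 2 * t\<^sup>2) (nhds 0)"
    by (rule L.char_second_order_at_0[OF _ _ _ d])
       (simp_all add: integrable_distr_eq integral_distr square_integrable mean second_moment)
  moreover have "eventually (\<lambda>t. cmod (char std_normal_distribution t - (1 - t\<^sup>2 / 2)) \<le> \<delta> / 2 * t\<^sup>2) (nhds 0)"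
    using std_normal_distribution_even_moments[of 1] integral_std_normal_distribution_moment_odd[of 1]
    by (intro N.char_second_order_at_0 d) simp_all
  ultimately have "eventually (\<lambda>t. cmod (char law t - of_real (exp (- t\<^sup>2 / 2))) \<le> \<delta> * t\<^sup>2) (nhds 0)"
  proof eventually_elim
    case (elim t)
    have "cmod (char law t - char std_normal_distribution t) \<le> \<delta> / 2 * t\<^sup>2 + \<delta> / 2 * t\<^sup>2"
      using elim by (rule norm_diff_triangle_le[OF _ norm_minus_commute[THEN eq_refl, THEN order_trans]])
    then show ?case by (simp add: char_std_normal_distribution)
  qed
  then show ?thesis
    using that by (auto simp: eventually_nhds_metric dist_real_def)
qed

section \<open>Product form of the characteristic function\<close>

lemma char_partial_sum:
  "char (distr M borel (\<lambda>\<omega>. c * (\<Sum>n<N. a ^ n * Y n \<omega>))) t = (\<Prod>n<N. char law (c * a ^ n * t))"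
proof -
  have scale: "char (distr M borel (\<lambda>\<omega>. b * Y n \<omega>)) t = char law (b * t)" for n b
    unfolding ident[of n, symmetric] char_def by (simp add: integral_distr ac_simps)
  have "char (distr M borel (\<lambda>\<omega>. \<Sum>n<N. c * a ^ n * Y n \<omega>)) t
      = (\<Prod>n<N. char (distr M borel (\<lambda>\<omega>. c * a ^ n * Y n \<omega>)) t)"
    by (intro char_distr_sum indep_vars_compose2[OF indep_vars_subset[OF indep]]) auto
  then show ?thesis
    unfolding scale by (simp add: sum_distrib_left mult.assoc)
qed

text \<open>Almost sure convergence of the partial sums passes to characteristic functions by
  dominated convergence, the integrands having modulus 1.\<close>

lemma char_discounted_sum_tendsto:
  assumes a: "0 \<le> a" "a < 1"
  shows "(\<lambda>N. \<Prod>n<N. char law (c * a ^ n * t))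
           \<longlonglongrightarrow> char (distr M borel (\<lambda>\<omega>. c * discounted_sum Y a \<omega>)) t"
proof -
  have char_eq: "char (distr M borel Z) t = (CLINT \<omega>|M. iexp (t * Z \<omega>))"
    if "random_variable borel Z" for Z
    using that by (simp add: char_def integral_distr)
  have "(\<lambda>N. CLINT \<omega>|M. iexp (t * (c * (\<Sum>n<N. a ^ n * Y n \<omega>))))
          \<longlonglongrightarrow> (CLINT \<omega>|M. iexp (t * (c * discounted_sum Y a \<omega>)))"
  proof (rule integral_dominated_convergence[where w="\<lambda>_. 1"])
    show "AE \<omega> in M. (\<lambda>N. iexp (t * (c * (\<Sum>n<N. a ^ n * Y n \<omega>))))
            \<longlonglongrightarrow> iexp (t * (c * discounted_sum Y a \<omega>))"
      using AE_partial_sums_tendsto[OF a] by eventually_elim (intro tendsto_intros)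
  qed simp_all
  then show ?thesis
    by (simp only: char_partial_sum[symmetric]) (simp add: char_eq)
qed

lemma normalized_geometric_sums:
  fixes a :: real
  assumes a: "0 \<le> a" "a < 1"
  shows "(\<lambda>n. (sqrt (1 - a\<^sup>2) * a ^ n)\<^sup>2) sums 1"
proof -
  have a2: "a\<^sup>2 < 1" using a by (simp add: power_less_one_iff)
  then have "(\<lambda>n. (1 - a\<^sup>2) * (a\<^sup>2) ^ n) sums ((1 - a\<^sup>2) * (1 / (1 - a\<^sup>2)))"
    by (intro sums_mult geometric_sums) simp
  moreover have "(sqrt (1 - a\<^sup>2) * a ^ n)\<^sup>2 = (1 - a\<^sup>2) * (a\<^sup>2) ^ n" for n
    using a2 by (simp add: power_mult_distrib power_mult[symmetric] mult.commute)
  ultimately show ?thesis using a2 by simp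
qed

text \<open>Both sides are limits of finite products, so a bound on the finite products that is
  uniform in \<open>N\<close> survives in the limit.\<close>

lemma char_discounted_sum_near_normal:
  fixes t :: real
  defines "c a \<equiv> sqrt (1 - a\<^sup>2)"
  assumes a: "0 \<le> a" "a < 1" and "\<delta> > 0"
    and near: "\<And>t. \<bar>t\<bar> < r \<Longrightarrow> cmod (char law t - of_real (exp (- t\<^sup>2 / 2))) \<le> \<delta> * t\<^sup>2"
    and t: "c a * \<bar>t\<bar> < r"
  shows "cmod (char (distr M borel (\<lambda>\<omega>. c a * discounted_sum Y a \<omega>)) t - of_real (exp (- t\<^sup>2 / 2)))
           \<le> \<delta> * t\<^sup>2"
proof (rule LIMSEQ_le_const2)
  let ?u = "\<lambda>n. c a * a ^ n * t" and ?g = "\<lambda>t. complex_of_real (exp (- t\<^sup>2 / 2))"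
  interpret L: real_distribution law by simp
  note sums = normalized_geometric_sums[OF a, folded c_def]
  have "c a \<ge> 0" using a by (simp add: c_def power_le_one)
  have prod_g: "(\<Prod>n<N. ?g (?u n)) = of_real (exp (- t\<^sup>2 / 2 * (\<Sum>n<N. (c a * a ^ n)\<^sup>2)))" for N
    by (simp add: sum_distrib_left power_mult_distrib ac_simps flip: of_real_prod exp_sum)
  have "(\<lambda>N. \<Sum>n<N. (c a * a ^ n)\<^sup>2) \<longlonglongrightarrow> 1"
    using sums by (simp add: sums_def)
  then have "(\<lambda>N. complex_of_real (exp (- t\<^sup>2 / 2 * (\<Sum>n<N. (c a * a ^ n)\<^sup>2))))
      \<longlonglongrightarrow> of_real (exp (- t\<^sup>2 / 2 * 1))"
    by (intro tendsto_intros)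
  then have "(\<lambda>N. \<Prod>n<N. ?g (?u n)) \<longlonglongrightarrow> ?g t"
    unfolding prod_g by simp
  then show "(\<lambda>N. cmod ((\<Prod>n<N. char law (?u n)) - (\<Prod>n<N. ?g (?u n))))
      \<longlonglongrightarrow> cmod (char (distr M borel (\<lambda>\<omega>. c a * discounted_sum Y a \<omega>)) t - ?g t)"
    by (intro tendsto_norm tendsto_diff char_discounted_sum_tendsto a)
  have "cmod ((\<Prod>n<N. char law (?u n)) - (\<Prod>n<N. ?g (?u n))) \<le> \<delta> * t\<^sup>2" for N
  proof -
    \<comment> \<open>Telescoping the product replaces one factor at a time; the remaining factors
      have modulus at most 1.\<close>
    have "cmod ((\<Prod>n<N. char law (?u n)) - (\<Prod>n<N. ?g (?u n)))
        \<le> (\<Sum>n<N. cmod (char law (?u n) - ?g (?u n)))"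
      by (intro norm_prod_diff) (auto simp: L.cmod_char_le_1)
    also have "\<dots> \<le> (\<Sum>n<N. \<delta> * (?u n)\<^sup>2)"
    proof (intro sum_mono near)
      fix n
      \<comment> \<open>Since \<open>a ^ n\<close> is at most 1, the single condition on
        \<open>c a * \<bar>t\<bar>\<close> puts the arguments of all factors below
        \<open>r\<close>.\<close>
      have "\<bar>?u n\<bar> = a ^ n * (c a * \<bar>t\<bar>)"
        using a \<open>c a \<ge> 0\<close> by (simp add: abs_mult)
      also have "\<dots> \<le> c a * \<bar>t\<bar>"
        using a \<open>c a \<ge> 0\<close> by (intro mult_left_le_one_le) (auto simp: power_le_one)
      finally show "\<bar>?u n\<bar> < r" using t by simp
    qed
    also have "\<dots> = \<delta> * t\<^sup>2 * (\<Sum>n<N. (c a * a ^ n)\<^sup>2)"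
      by (simp add: sum_distrib_left power_mult_distrib ac_simps)
    also have "\<dots> \<le> \<delta> * t\<^sup>2 * 1"
      using sums \<open>\<delta> > 0\<close>
      by (intro mult_left_mono) (auto simp: sums_iff intro!: sum_le_suminf[THEN order_trans])
    finally show ?thesis by simp
  qed
  then show "\<exists>N0. \<forall>N\<ge>N0. cmod ((\<Prod>n<N. char law (?u n)) - (\<Prod>n<N. ?g (?u n))) \<le> \<delta> * t\<^sup>2"
    by blast
qed

text \<open>The assumption \<open>close\<close> is what makes the trivial bound 2 at most
  \<open>\<delta> * \<xi>\<^sup>2\<close> as soon as \<open>c a * \<bar>\<xi>\<bar> \<ge> r\<close>;
  smaller frequencies are covered by the local estimate.\<close>

lemma fourier_dist_le:
  defines "c a \<equiv> sqrt (1 - a\<^sup>2)"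
  assumes a: "0 \<le> a" "a < 1" and "\<delta> > 0" "r > 0"
    and near: "\<And>t. \<bar>t\<bar> < r \<Longrightarrow> cmod (char law t - of_real (exp (- t\<^sup>2 / 2))) \<le> \<delta> * t\<^sup>2"
    and close: "2 * (1 - a\<^sup>2) \<le> \<delta> * r\<^sup>2"
  shows "fourier_dist 2 (cdf (distr M borel (\<lambda>\<omega>. c a * discounted_sum Y a \<omega>))) std_normal_df
           \<le> ennreal \<delta>"
  unfolding fourier_dist_def
proof (rule SUP_least)
  fix \<xi> :: real assume "\<xi> \<in> - {0}"
  let ?D = "distr M borel (\<lambda>\<omega>. c a * discounted_sum Y a \<omega>)"
  interpret D: real_distribution ?D by simp
  have "a\<^sup>2 < 1" using a by (simp add: power_less_one_iff)
  then have c: "c a > 0" "(c a)\<^sup>2 = 1 - a\<^sup>2" by (auto simp: c_def)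
  \<comment> \<open>The argument is negated because \<open>char_df\<close> and \<open>char\<close>
    have opposite signs in the exponent; the Gaussian term is even.\<close>
  have "cmod (char ?D (- \<xi>) - of_real (exp (- \<xi>\<^sup>2 / 2))) \<le> \<delta> * \<xi>\<^sup>2"
  proof (cases "c a * \<bar>\<xi>\<bar> < r")
    case True
    then show ?thesis
      using char_discounted_sum_near_normal[OF a \<open>\<delta> > 0\<close> near, where t="- \<xi>"] by (simp add: c_def)
  next
    case False
    have "cmod (char ?D (- \<xi>) - of_real (exp (- \<xi>\<^sup>2 / 2))) \<le> 1 + 1"
      by (intro order_trans[OF norm_triangle_ineq4] add_mono D.cmod_char_le_1) simp
    also have "\<dots> \<le> \<delta> * \<xi>\<^sup>2"
    proof -
      have "r\<^sup>2 \<le> (c a * \<bar>\<xi>\<bar>)\<^sup>2"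
        using False \<open>r > 0\<close> by (intro power_mono) auto
      then have "\<delta> * r\<^sup>2 \<le> \<delta> * ((1 - a\<^sup>2) * \<xi>\<^sup>2)"
        using \<open>\<delta> > 0\<close> c by (simp add: power_mult_distrib)
      with close have "(1 - a\<^sup>2) * 2 \<le> (1 - a\<^sup>2) * (\<delta> * \<xi>\<^sup>2)"
        by (simp add: algebra_simps)
      then show ?thesis
        using \<open>a\<^sup>2 < 1\<close> by (subst (asm) mult_le_cancel_left_pos) auto
    qed
    finally show ?thesis .
  qed
  then show "ennreal (cmod (char_df (cdf ?D) \<xi> - char_df std_normal_df \<xi>) / \<bar>\<xi>\<bar> powr 2) \<le> ennreal \<delta>"
    using \<open>\<xi> \<in> - {0}\<close>
    by (intro ennreal_leI)
       (simp add: char_df_cdf std_normal_df_eq_cdf real_dist_normal_dist char_std_normal_distribution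
         divide_le_eq)
qed

lemma fourier_dist_tendsto_0:
  "((\<lambda>a. fourier_dist 2 (cdf (distr M borel (\<lambda>\<omega>. sqrt (1 - a\<^sup>2) * discounted_sum Y a \<omega>)))
      std_normal_df) \<longlongrightarrow> 0) (at_left 1)"
proof (rule order_tendstoI)
  fix e :: ennreal assume "0 < e"
  \<comment> \<open>An intermediate value is finite even if \<open>e\<close> is infinite, and it
    turns the non-strict bound into the strict one required.\<close>
  then obtain e' where "0 < e'" "e' < e" using dense by blast
  then obtain \<delta> where \<delta>: "e' = ennreal \<delta>" "\<delta> > 0"
    by (cases e') auto
  \<comment> \<open>The radius depends only on \<delta> and the law, so it is fixed before
    \<open>a\<close> approaches 1.\<close>
  obtain r where r: "r > 0"
    "\<And>t. \<bar>t\<bar> < r \<Longrightarrow> cmod (char law t - of_real (exp (- t\<^sup>2 / 2))) \<le> \<delta> * t\<^sup>2"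
    using char_law_near_normal[OF \<open>\<delta> > 0\<close>] by blast
  have "((\<lambda>a::real. 2 * (1 - a\<^sup>2)) \<longlongrightarrow> 2 * (1 - 1\<^sup>2)) (at_left 1)"
    by (intro tendsto_intros)
  then have "eventually (\<lambda>a::real. 2 * (1 - a\<^sup>2) < \<delta> * r\<^sup>2) (at_left 1)"
    using \<delta> r by (intro order_tendstoD(2)) auto
  moreover have "eventually (\<lambda>a::real. a \<in> {0<..<1}) (at_left 1)"
    by (rule eventually_at_leftI[of 0]) auto
  ultimately show "eventually (\<lambda>a. fourier_dist 2
      (cdf (distr M borel (\<lambda>\<omega>. sqrt (1 - a\<^sup>2) * discounted_sum Y a \<omega>))) std_normal_df < e) (at_left 1)"
  proof eventually_elim
    case (elim a)
    then show ?case
      using fourier_dist_le[OF _ _ \<delta>(2) r, of a] \<open>e' < e\<close> \<delta> by (auto intro: le_less_trans)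
  qed
qed simp

end

section \<open>Reduction to the standardized case\<close>

theorem theorem1:
  fixes M :: "'a measure" and X :: "nat \<Rightarrow> 'a \<Rightarrow> real" and \<mu> \<sigma> :: real
  assumes "prob_space M"
    and "prob_space.indep_vars M (\<lambda>_. borel) X UNIV"
    and "\<And>n. distr M borel (X n) = distr M borel (X 0)"
    and "integrable M (\<lambda>\<omega>. (X 0 \<omega>)\<^sup>2)"
    and "\<mu> = prob_space.expectation M (X 0)"
    and "\<sigma>\<^sup>2 = prob_space.variance M (X 0)"
    and "\<sigma> > 0"
  shows "(\<forall>a\<in>{0..<1}. \<forall>\<omega>. standardized M (discounted_sum X a) \<omega> =
            sqrt (1 - a\<^sup>2) / \<sigma> * (discounted_sum X a \<omega> - \<mu> / (1 - a))) \<and>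
         ((\<lambda>a. fourier_dist 2 (dist_fun M (standardized M (discounted_sum X a))) std_normal_df)
            \<longlongrightarrow> 0) (at_left 1)"
proof -
  interpret prob_space M by fact
  define Y where "Y n \<omega> = (X n \<omega> - \<mu>) / \<sigma>" for n \<omega>
  have meas_X [measurable]: "random_variable borel (X n)" for n
    using assms(2) by (auto simp: indep_vars_def2)
  have meas_S [measurable]: "random_variable borel (discounted_sum X a)" for a
    unfolding discounted_sum_def[abs_def] by measurable
  have int_X: "integrable M (X 0)"
    by (rule square_integrable_imp_integrable[OF _ assms(4)]) simp
  have int_sq: "integrable M (\<lambda>\<omega>. (X 0 \<omega> - \<mu>)\<^sup>2)"
    using int_X assms(4) by (simp add: power2_diff)
  interpret Y: iid_standardized M Y
  proof
    show "indep_vars (\<lambda>_. borel) Y UNIV"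
      unfolding Y_def[abs_def] using assms(2) by (rule indep_vars_compose2) simp
    show "distr M borel (Y n) = distr M borel (Y 0)" for n
    proof -
      have "distr M borel (Y n) = distr (distr M borel (X n)) borel (\<lambda>x. (x - \<mu>) / \<sigma>)" for n
        by (subst distr_distr) (auto simp: Y_def[abs_def] comp_def)
      then show ?thesis using assms(3)[of n] by simp
    qed
    show "integrable M (\<lambda>\<omega>. (Y 0 \<omega>)\<^sup>2)"
      using int_sq by (simp add: Y_def power_divide)
    show "expectation (Y 0) = 0"
      using int_X assms(5) by (simp add: Y_def[abs_def] prob_space)
    have "expectation (\<lambda>\<omega>. (X 0 \<omega> - \<mu>)\<^sup>2) = \<sigma>\<^sup>2"
      using assms(5,6) by simp
    then show "expectation (\<lambda>\<omega>. (Y 0 \<omega>)\<^sup>2) = 1"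
      using \<open>\<sigma> > 0\<close> by (simp add: Y_def power_divide)
  qed
  \<comment> \<open>Convergence holds only almost surely; where the series diverges its value is
    unspecified and the identity need not hold.\<close>
  have affine: "AE \<omega> in M. discounted_sum X a \<omega> = \<sigma> * discounted_sum Y a \<omega> + \<mu> / (1 - a)"
    if a: "0 \<le> a" "a < 1" for a
    using Y.AE_summable[OF a]
  proof eventually_elim
    case (elim \<omega>)
    have "(\<lambda>n. \<sigma> * (a ^ n * Y n \<omega>) + \<mu> * a ^ n) sums (\<sigma> * discounted_sum Y a \<omega> + \<mu> * (1 / (1 - a)))"
      unfolding discounted_sum_def using elim a
      by (intro sums_add sums_mult summable_sums geometric_sums) auto
    moreover have "\<sigma> * (a ^ n * Y n \<omega>) + \<mu> * a ^ n = a ^ n * X n \<omega>" for n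
      using \<open>\<sigma> > 0\<close> by (simp add: Y_def field_simps)
    ultimately show ?case
      by (simp add: discounted_sum_def sums_iff)
  qed
  have mean: "expectation (discounted_sum X a) = \<mu> / (1 - a)" if a: "0 \<le> a" "a < 1" for a
  proof -
    have "expectation (discounted_sum X a) = expectation (\<lambda>\<omega>. \<sigma> * discounted_sum Y a \<omega> + \<mu> / (1 - a))"
      by (rule integral_cong_AE) (use affine[OF a] in auto)
    then show ?thesis
      using Y.discounted_sum_mean[OF a] by (simp add: prob_space)
  qed
  have var: "variance (discounted_sum X a) = \<sigma>\<^sup>2 / (1 - a\<^sup>2)" if a: "0 \<le> a" "a < 1" for a
  proof -
    have "variance (discounted_sum X a) = expectation (\<lambda>\<omega>. \<sigma>\<^sup>2 * (discounted_sum Y a \<omega>)\<^sup>2)"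
      unfolding mean[OF a]
    proof (rule integral_cong_AE)
      show "AE \<omega> in M. (discounted_sum X a \<omega> - \<mu> / (1 - a))\<^sup>2 = \<sigma>\<^sup>2 * (discounted_sum Y a \<omega>)\<^sup>2"
        using affine[OF a] by eventually_elim (simp add: power_mult_distrib)
    qed measurable
    then show ?thesis
      using Y.discounted_sum_second_moment[OF a] by simp
  qed
  \<comment> \<open>Only the constants for mean and variance are substituted, so this identity holds
    at every \<omega>, even where the series diverges.\<close>
  have std: "standardized M (discounted_sum X a) \<omega> =
      sqrt (1 - a\<^sup>2) / \<sigma> * (discounted_sum X a \<omega> - \<mu> / (1 - a))" if a: "0 \<le> a" "a < 1" for a \<omega>
    unfolding standardized_def mean[OF a] var[OF a, unfolded mean[OF a]]
    using \<open>\<sigma> > 0\<close> by (simp add: real_sqrt_divide)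
  \<comment> \<open>Distribution functions do not see null sets, so the almost sure affine relation
    suffices.\<close>
  have law_eq: "dist_fun M (standardized M (discounted_sum X a)) =
      cdf (distr M borel (\<lambda>\<omega>. sqrt (1 - a\<^sup>2) * discounted_sum Y a \<omega>))" if a: "0 \<le> a" "a < 1" for a
  proof -
    have [measurable]: "random_variable borel (standardized M (discounted_sum X a))"
      unfolding standardized_def[abs_def] by measurable
    have "AE \<omega> in M. standardized M (discounted_sum X a) \<omega> = sqrt (1 - a\<^sup>2) * discounted_sum Y a \<omega>"
      using affine[OF a] by eventually_elim (use \<open>\<sigma> > 0\<close> in \<open>simp add: std[OF a]\<close>)
    then have "distr M borel (standardized M (discounted_sum X a)) =
        distr M borel (\<lambda>\<omega>. sqrt (1 - a\<^sup>2) * discounted_sum Y a \<omega>)"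
      by (intro distr_cong_AE) auto
    then show ?thesis by (simp add: dist_fun_eq_cdf)
  qed
  have "eventually (\<lambda>a::real. a \<in> {0<..<1}) (at_left 1)"
    by (rule eventually_at_leftI[of 0]) auto
  then have "eventually (\<lambda>a. fourier_dist 2 (cdf (distr M borel (\<lambda>\<omega>. sqrt (1 - a\<^sup>2) * discounted_sum Y a \<omega>)))
      std_normal_df = fourier_dist 2 (dist_fun M (standardized M (discounted_sum X a))) std_normal_df) (at_left 1)"
    by eventually_elim (simp add: law_eq)
  from Lim_transform_eventually[OF Y.fourier_dist_tendsto_0 this] std
  show ?thesis by simp
qed

end
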